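(* (Knuth-like charge and polarity balanced construction.) Let $q\ge 4$, and let $k$ be a positive integer which is even if $q$ is even. Consider the following procedures for information sequences ${\bf u}\in({\cal A}_q)^k$, with $\xi$, $\nu$, ${\bf b}_i$, $\oplus$ and the PB encoding and decoding procedures as defined in the context. CPB encoding procedure: 1) Apply the PB encoding procedure (without its prefix) to change the information sequence ${\bf u}$ into a PB sequence ${\bf y}$, using an appropriate offset $a$ (if $q$ is odd) and PB index $z$. Let $k'$ be the common number of positive and of negative symbols in ${\bf y}$. 2) Compute $\xi$ from ${\bf y}$. 3) If $\xi=1$, then replace all symbols $y_i$ in ${\bf y}^+$ by $2\lceil q/2\rceil-y_i$; else leave them untouched. Call the resulting sequence ${\bf z}$. 4) Compute $\nu$ from ${\bf z}$. 5) Determine an index $w\in\{0,1,\ldots,\lfloor q/2\rfloor k'-1\}$ such that $${\rm Sum}({\bf z}^{\nu}\oplus{\bf b}_w)=-{\rm Sum}({\bf z}^{\bar\nu}).$$ 6) Replace in ${\bf z}$ the subsequence ${\bf z}^\nu$ by ${\bf z}^\nu\oplus{\bf b}_w$, to obtain the sequence ${\bf x}$. 7) Map $(z,\xi,\nu,w)$ (if $q$ is even) or $(a,z,\xi,\nu,w)$ (if $q$ is odd) to a unique CPB prefix ${\bf p}$. The codeword is ${\bf c}=({\bf p},{\bf x})$. CPB decoding procedure: 1) Retrieve $a$ (if $q$ is odd), $z$, $\xi$, $\nu$, and $w$ from the prefix ${\bf p}$. 2) Replace ${\bf x}^\nu$ by ${\bf x}^\nu\oplus(-{\bf b}_w)$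 in ${\bf x}$ to obtain ${\bf z}$. 3) If $\xi=1$, then replace all symbols $z_i$ in ${\bf z}^+$ by $2\lceil q/2\rceil-z_i$; else leave them untouched. Call the resulting sequence ${\bf y}$. 4) Apply the PB decoding procedure to retrieve ${\bf u}$ from ${\bf y}$, using $a$ (if $q$ is odd) and $z$. Then the construction is valid: for every information sequence ${\bf u}\in({\cal A}_q)^k$, a suitable offset $a$ (if $q$ is odd) and PB index $z$ exist, and there always exists at least one $w\in\{0,1,\ldots,\lfloor q/2\rfloor k'-1\}$ satisfying the equation in step 5; the resulting sequence ${\bf x}$ satisfies ${\rm Sum}({\bf x}^+)+{\rm Sum}({\bf x}^-)=0$ and is CPB, so that ${\bf c}=({\bf p},{\bf x})$ is balanced (CPB); and the decoding procedure properly reverses the operations of the encoding procedure, so that it retrieves ${\bf u}$ from ${\bf c}$.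
   Context: For an integer $q\ge 2$, ${\cal A}_q=\{-q+1,-q+3,\ldots,q-3,q-1\}$, ${\cal A}_q^+=\{j\in{\cal A}_q:j>0\}$ and ${\cal A}_q^-=\{j\in{\cal A}_q:j<0\}$. ${\rm Sum}({\bf y})$ is the real sum of all symbols of the sequence ${\bf y}$. A sequence over ${\cal A}_q$ is charge-balanced (CB) if the sum of its symbols is $0$, polarity-balanced (PB) if its number of positive symbols equals its number of negative symbols, and CPB if it is both CB and PB. For a sequence ${\bf y}$, ${\bf y}^+$ (resp. ${\bf y}^-$) is the subsequence consisting of all positive (resp. negative) symbols of ${\bf y}$. $({\bf p},{\bf x})$ denotes concatenation. Mapping parameters to a unique CPB prefix means applying a fixed injective map from the set of possible parameter tuples into the CPB sequences over ${\cal A}_q$ of some fixed length $p$. PB encoding of ${\bf u}\in({\cal A}_q)^k$: if $q$ is odd, determine a symbol $a\in{\cal A}_q$ whose number of appearances in ${\bf u}$ has the same parity as $k$, and compute ${\bf u}'={\bf u}\oplus_{2q}(-a,\ldots,-a)$, where $\oplus_{2q}$ denotes componentwise addition over the integers with a reduction modulo $2q$ such that the outcome is in ${\cal A}_q$; if $q$ is even, ${\bf u}'={\bf u}$. Determine a PB index $z\in\{0,1,\ldots,k-1\}$, i.e., an index such that multiplying the first $z$ symbols of ${\bf u}'$ by $-1$ gives a PB sequence; that PB sequence is the result ${\bf y}$. PB decoding of ${\bf y}$: multiply the first $z$ symbols of ${\bf y}$ by $-1$ and then, if $q$ is odd, add $(a,\ldots,a)$ with $\oplus_{2q}$. For a PB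 sequence ${\bf y}$ with $k'$ positive and $k'$ negative symbols: $\xi=1$ if ${\rm Sum}({\bf y}^+)<k'\lceil q/2\rceil<-{\rm Sum}({\bf y}^-)$ or $-{\rm Sum}({\bf y}^-)<k'\lceil q/2\rceil<{\rm Sum}({\bf y}^+)$, and $\xi=0$ otherwise. For the sequence ${\bf z}$ obtained from ${\bf y}$ in step 3 of the encoding (not to be confused with the index $z$): $\nu=+$ if ${\rm Sum}({\bf z}^+)\ge-{\rm Sum}({\bf z}^-)\ge k'\lceil q/2\rceil$ or ${\rm Sum}({\bf z}^+)\le-{\rm Sum}({\bf z}^-)\le k'\lceil q/2\rceil$, and $\nu=-$ otherwise; $\bar\nu$ denotes the inverse (opposite sign) of $\nu$. For $i=0,1,\ldots,\lfloor q/2\rfloor k'-1$, ${\bf b}_i$ is the sequence of length $k'$ consisting of $g$ symbols $j+2$ followed by $k'-g$ symbols $j$, where $j=2\lfloor i/k'\rfloor$ and $g=i-k'\lfloor i/k'\rfloor$. $\oplus$ denotes componentwise addition over the integers with a reduction modulo $2\lfloor q/2\rfloor$ such that the outcome is in ${\cal A}_q^+$ if $\nu=+$ and in ${\cal A}_q^-$ if $\nu=-$.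
   Formalization: If k'=0 (y all zero; possible for odd q, e.g. q=5, k=1, u=(0)), the range {0,…,⌊q/2⌋k'−1} is empty and no w exists as literally claimed; in this case only, the range of w is taken to be {0}, with b_0 empty. *)

theory Defs
  imports Complex_Main "HOL-Number_Theory.Cong"
begin

section \<open>Alphabet, sequences and balance\<close>

definition alphabet :: "nat \<Rightarrow> int set" where
  "alphabet q = (\<lambda>i. 2 * int i - (int q - 1)) ` {0..<q}"

definition seqs :: "nat \<Rightarrow> nat \<Rightarrow> int list set" where
  "seqs q n = {u. length u = n \<and> set u \<subseteq> alphabet q}"

datatype polarity = Pos | Neg

fun opposite :: "polarity \<Rightarrow> polarity" where
  "opposite Pos = Neg"
| "opposite Neg = Pos"

fun has_polarity :: "polarity \<Rightarrow> int \<Rightarrow> bool" where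
  "has_polarity Pos s \<longleftrightarrow> s > 0"
| "has_polarity Neg s \<longleftrightarrow> s < 0"

definition alphabet_part :: "polarity \<Rightarrow> nat \<Rightarrow> int set" where
  "alphabet_part \<nu> q = {j \<in> alphabet q. has_polarity \<nu> j}"

definition part :: "polarity \<Rightarrow> int list \<Rightarrow> int list" where
  "part \<nu> y = filter (has_polarity \<nu>) y"

definition charge_balanced :: "int list \<Rightarrow> bool" where
  "charge_balanced y \<longleftrightarrow> sum_list y = 0"

definition polarity_balanced :: "int list \<Rightarrow> bool" where
  "polarity_balanced y \<longleftrightarrow> length (part Pos y) = length (part Neg y)"

definition cpb_seqs :: "nat \<Rightarrow> nat \<Rightarrow> int list set" where
  "cpb_seqs q n = {y \<in> seqs q n. charge_balanced y \<and> polarity_balanced y}"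

text \<open>
  The representative is unique where this is used below: \<open>S\<close> consists of symbols of one parity
  forming a full system of residues of that parity modulo the even number \<open>m\<close>.
\<close>

definition reduce_into :: "int set \<Rightarrow> int \<Rightarrow> int \<Rightarrow> int" where
  "reduce_into S m t = (THE r. r \<in> S \<and> [r = t] (mod m))"

definition add_into :: "int set \<Rightarrow> int \<Rightarrow> int list \<Rightarrow> int list \<Rightarrow> int list" where
  "add_into S m xs ys = map2 (\<lambda>s t. reduce_into S m (s + t)) xs ys"

section \<open>Polarity balancing\<close>

definition add_2q :: "nat \<Rightarrow> int list \<Rightarrow> int list \<Rightarrow> int list" where
  "add_2q q = add_into (alphabet q) (2 * int q)"

text \<open>The offset is an option: \<open>Some a\<close> for odd \<open>q\<close>, while for even \<open>q\<close> there is no offset.\<close>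

definition is_offset :: "nat \<Rightarrow> int list \<Rightarrow> int option \<Rightarrow> bool" where
  "is_offset q u ao \<longleftrightarrow>
     (if odd q then \<exists>a \<in> alphabet q. ao = Some a \<and> (even (count_list u a) \<longleftrightarrow> even (length u))
      else ao = None)"

fun shift_seq :: "nat \<Rightarrow> int option \<Rightarrow> int list \<Rightarrow> int list" where
  "shift_seq q None u = u"
| "shift_seq q (Some a) u = add_2q q u (replicate (length u) (- a))"

fun unshift_seq :: "nat \<Rightarrow> int option \<Rightarrow> int list \<Rightarrow> int list" where
  "unshift_seq q None u = u"
| "unshift_seq q (Some a) u = add_2q q u (replicate (length u) a)"

definition negate_first :: "nat \<Rightarrow> int list \<Rightarrow> int list" where
  "negate_first z u = map uminus (take z u) @ drop z u"

definition is_pb_index :: "int list \<Rightarrow> nat \<Rightarrow> bool" where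
  "is_pb_index u' z \<longleftrightarrow> z \<in> {0..<length u'} \<and> polarity_balanced (negate_first z u')"

definition pb_encode :: "nat \<Rightarrow> int option \<Rightarrow> nat \<Rightarrow> int list \<Rightarrow> int list" where
  "pb_encode q ao z u = negate_first z (shift_seq q ao u)"

definition pb_decode :: "nat \<Rightarrow> int option \<Rightarrow> nat \<Rightarrow> int list \<Rightarrow> int list" where
  "pb_decode q ao z y = unshift_seq q ao (negate_first z y)"

section \<open>Charge and polarity balancing\<close>

definition ceil_half :: "nat \<Rightarrow> int" where
  "ceil_half q = \<lceil>real q / 2\<rceil>"

definition floor_half :: "nat \<Rightarrow> nat" where
  "floor_half q = q div 2"

definition xi :: "nat \<Rightarrow> int list \<Rightarrow> nat" where
  "xi q y =
     (let m = int (length (part Pos y)) * ceil_half q;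
          P = sum_list (part Pos y);
          N = - sum_list (part Neg y)
      in if P < m \<and> m < N \<or> N < m \<and> m < P then 1 else 0)"

definition reflect_pos :: "nat \<Rightarrow> nat \<Rightarrow> int list \<Rightarrow> int list" where
  "reflect_pos q \<xi> y = (if \<xi> = 1 then map (\<lambda>s. if s > 0 then 2 * ceil_half q - s else s) y else y)"

definition nu :: "nat \<Rightarrow> nat \<Rightarrow> int list \<Rightarrow> polarity" where
  "nu q k' zs =
     (let m = int k' * ceil_half q;
          P = sum_list (part Pos zs);
          N = - sum_list (part Neg zs)
      in if P \<ge> N \<and> N \<ge> m \<or> P \<le> N \<and> N \<le> m then Pos else Neg)"

definition b_seq :: "nat \<Rightarrow> nat \<Rightarrow> int list" where
  "b_seq k' i =
     (let j = 2 * int (i div k'); g = i - k' * (i div k')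
      in replicate g (j + 2) @ replicate (k' - g) j)"

definition add_pol :: "nat \<Rightarrow> polarity \<Rightarrow> int list \<Rightarrow> int list \<Rightarrow> int list" where
  "add_pol q \<nu> = add_into (alphabet_part \<nu> q) (2 * int (floor_half q))"

text \<open>
  Replaces the subsequence \<open>part \<nu> y\<close> of \<open>y\<close>, in place, by a sequence of the same length.
\<close>

fun replace_part :: "polarity \<Rightarrow> int list \<Rightarrow> int list \<Rightarrow> int list" where
  "replace_part \<nu> [] vs = []"
| "replace_part \<nu> (s # ss) vs =
     (if has_polarity \<nu> s then hd vs # replace_part \<nu> ss (tl vs) else s # replace_part \<nu> ss vs)"

text \<open>
  If \<open>q\<close> is odd, the polarity balanced sequence may be all zero (for odd \<open>k\<close> this is unavoidable
  when all symbols of the information sequence coincide). Then \<open>k' = 0\<close> and the index range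
  \<open>{0, \<dots>, \<lfloor>q/2\<rfloor> k' - 1}\<close> is empty, although nothing has to be changed; in this case only,
  the range is taken to be \<open>{0}\<close>, with \<open>b_seq 0 0 = []\<close>.
\<close>

definition w_range :: "nat \<Rightarrow> nat \<Rightarrow> nat set" where
  "w_range q k' = (if k' = 0 then {0} else {0..<floor_half q * k'})"

definition is_w_index :: "nat \<Rightarrow> nat \<Rightarrow> polarity \<Rightarrow> int list \<Rightarrow> nat \<Rightarrow> bool" where
  "is_w_index q k' \<nu> zs w \<longleftrightarrow>
     w \<in> w_range q k' \<and>
     sum_list (add_pol q \<nu> (part \<nu> zs) (b_seq k' w)) = - sum_list (part (opposite \<nu>) zs)"

definition add_w :: "nat \<Rightarrow> nat \<Rightarrow> polarity \<Rightarrow> nat \<Rightarrow> int list \<Rightarrow> int list" where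
  "add_w q k' \<nu> w zs = replace_part \<nu> zs (add_pol q \<nu> (part \<nu> zs) (b_seq k' w))"

definition sub_w :: "nat \<Rightarrow> nat \<Rightarrow> polarity \<Rightarrow> nat \<Rightarrow> int list \<Rightarrow> int list" where
  "sub_w q k' \<nu> w xs = replace_part \<nu> xs (add_pol q \<nu> (part \<nu> xs) (map uminus (b_seq k' w)))"

text \<open>The tuple \<open>(a, z, \<xi>, \<nu>, w)\<close>; its first component is \<open>None\<close> for even \<open>q\<close>.\<close>

type_synonym params = "int option \<times> nat \<times> nat \<times> polarity \<times> nat"

text \<open>
  The encoder may choose any suitable offset, PB index and index \<open>w\<close>, so encoding is a relation:
  \<open>cpb_encoding q u (ao, z, \<xi>, \<nu>, w) xs\<close> states that these parameters can arise in
  encoding \<open>u\<close> and then lead to the sequence \<open>xs\<close>.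
\<close>

definition cpb_encoding :: "nat \<Rightarrow> int list \<Rightarrow> params \<Rightarrow> int list \<Rightarrow> bool" where
  "cpb_encoding q u t xs \<longleftrightarrow>
     (case t of (ao, z, \<xi>, \<nu>, w) \<Rightarrow>
        is_offset q u ao \<and> is_pb_index (shift_seq q ao u) z \<and>
        (let y = pb_encode q ao z u; k' = length (part Pos y); zs = reflect_pos q \<xi> y
         in \<xi> = xi q y \<and> \<nu> = nu q k' zs \<and> is_w_index q k' \<nu> zs w \<and> xs = add_w q k' \<nu> w zs))"

definition possible_params :: "nat \<Rightarrow> nat \<Rightarrow> params set" where
  "possible_params q k = {t. \<exists>u \<in> seqs q k. \<exists>xs. cpb_encoding q u t xs}"

definition prefix_map :: "nat \<Rightarrow> nat \<Rightarrow> nat \<Rightarrow> (params \<Rightarrow> int list) \<Rightarrow> bool" where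
  "prefix_map q k p \<phi> \<longleftrightarrow>
     inj_on \<phi> (possible_params q k) \<and> \<phi> ` possible_params q k \<subseteq> cpb_seqs q p"

definition cpb_decode :: "nat \<Rightarrow> nat \<Rightarrow> nat \<Rightarrow> (params \<Rightarrow> int list) \<Rightarrow> int list \<Rightarrow> int list" where
  "cpb_decode q k p \<phi> c =
     (case inv_into (possible_params q k) \<phi> (take p c) of (ao, z, \<xi>, \<nu>, w) \<Rightarrow>
        let xs = drop p c;
            zs = sub_w q (length (part Pos xs)) \<nu> w xs;
            y = reflect_pos q \<xi> zs
        in pb_decode q ao z y)"

end

(*
  Negating a growing prefix changes the difference between the numbers of positive and negative
  symbols from d to -d in steps of at most 2, which gives a PB index. For the charge, the
  reflection puts the sums P and N of the two parts (in absolute value) on the same side of their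
  mean value k' * ceil (q/2), and nu selects the part whose sum is at least as far from the mean.
  As i runs through its range, every symbol of that part runs equally often through all symbols
  of its polarity, so that the sums of z^nu + b_i average to the mean. Consecutive sums increase
  by at most 2 and have constant parity, hence the other sum is attained.
*)

theory Submission
  imports Defs
begin

section \<open>Reduction into arithmetic progressions\<close>

text \<open>The whole alphabet and each of its signed parts have this form, so one treatment of
  \<open>reduce_into\<close> serves both additions, modulo \<open>2 * q\<close> and modulo
  \<open>2 * floor_half q\<close>.\<close>

definition progression :: "int \<Rightarrow> nat \<Rightarrow> int set" where
  "progression lo n = {x. even (x - lo) \<and> lo \<le> x \<and> x < lo + 2 * int n}"

text \<open>Offsets of members from \<open>lo\<close> lie in the interval from 0 to
  \<open>2 * n - 1\<close>, so members congruent modulo \<open>2 * n\<close> coincide; this makes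
  the definite description well defined.\<close>

lemma reduce_into_eqI:
  assumes "r \<in> progression lo n" "[r = t] (mod (2 * int n))"
  shows "reduce_into (progression lo n) (2 * int n) t = r"
  unfolding reduce_into_def
proof (rule the_equality)
  show "r \<in> progression lo n \<and> [r = t] (mod (2 * int n))" using assms by simp
  fix s assume s: "s \<in> progression lo n \<and> [s = t] (mod (2 * int n))"
  then have "[s - lo = r - lo] (mod (2 * int n))"
    using assms(2) by (meson cong_diff cong_refl cong_sym cong_trans)
  then have "(s - lo) mod (2 * int n) = (r - lo) mod (2 * int n)" by (simp add: cong_def)
  then show "s = r" using s assms(1) by (simp add: progression_def)
qed

lemma mod_in_progression:
  assumes "n > 0" "even (t - lo)"
  shows "lo + (t - lo) mod (2 * int n) \<in> progression lo n"
    and "[lo + (t - lo) mod (2 * int n) = t] (mod (2 * int n))"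
proof -
  \<comment> \<open>The modulus is even, so taking the remainder preserves parity.\<close>
  have "even ((t - lo) mod (2 * int n))"
    using assms(2) by (simp add: dvd_mod)
  then show "lo + (t - lo) mod (2 * int n) \<in> progression lo n"
    using assms(1) by (simp add: progression_def)
  have "[lo + (t - lo) mod (2 * int n) = lo + (t - lo)] (mod (2 * int n))"
    by (intro cong_add cong_refl) (simp add: cong_def)
  then show "[lo + (t - lo) mod (2 * int n) = t] (mod (2 * int n))" by simp
qed

lemma reduce_into_progression:
  assumes "n > 0" "even (t - lo)"
  shows "reduce_into (progression lo n) (2 * int n) t = lo + (t - lo) mod (2 * int n)"
  by (rule reduce_into_eqI) (rule mod_in_progression[OF assms])+

lemma reduce_into_props:
  assumes "n > 0" "even (t - lo)"
  shows "reduce_into (progression lo n) (2 * int n) t \<in> progression lo n"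
    and "[reduce_into (progression lo n) (2 * int n) t = t] (mod (2 * int n))"
  unfolding reduce_into_progression[OF assms] by (rule mod_in_progression[OF assms])+

lemma length_add_into [simp]: "length (add_into S m xs ys) = min (length xs) (length ys)"
  by (simp add: add_into_def)

lemma add_into_subset:
  assumes "n > 0" "set xs \<subseteq> progression lo n" "\<forall>t \<in> set ys. even t"
  shows "set (add_into (progression lo n) (2 * int n) xs ys) \<subseteq> progression lo n"
proof
  fix x assume "x \<in> set (add_into (progression lo n) (2 * int n) xs ys)"
  then obtain s t where st: "s \<in> set xs" "t \<in> set ys"
      "x = reduce_into (progression lo n) (2 * int n) (s + t)"
    by (auto simp: add_into_def dest: set_zip_leftD set_zip_rightD)
  have "even (s + t - lo)" using st assms by (auto simp: progression_def)
  then show "x \<in> progression lo n" using st(3) reduce_into_props(1)[OF assms(1)] by simp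
qed

text \<open>Subtracting \<open>t\<close> from the representative of \<open>s + t\<close> gives a
  number congruent to \<open>s\<close>, and \<open>s\<close> is itself a representative. Both
  decoding steps that undo a modular addition rest on this.\<close>

lemma add_into_uminus_cancel:
  assumes "n > 0" "length xs = length ys"
    "set xs \<subseteq> progression lo n" "\<forall>t \<in> set ys. even t"
  shows "add_into (progression lo n) (2 * int n)
      (add_into (progression lo n) (2 * int n) xs ys) (map uminus ys) = xs"
  using assms(2-)
proof (induction xs ys rule: list_induct2)
  case Nil
  then show ?case by (simp add: add_into_def)
next
  case (Cons s ss t ts)
  have s: "s \<in> progression lo n" "even t" using Cons.prems by auto
  then have "even (s + t - lo)" by (auto simp: progression_def)
  then have "[reduce_into (progression lo n) (2 * int n) (s + t) = s + t] (mod (2 * int n))"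
    by (rule reduce_into_props(2)[OF assms(1)])
  then have "[reduce_into (progression lo n) (2 * int n) (s + t) - t = s + t - t] (mod (2 * int n))"
    by (intro cong_diff cong_refl)
  then have "reduce_into (progression lo n) (2 * int n)
      (reduce_into (progression lo n) (2 * int n) (s + t) - t) = s"
    using s(1) by (intro reduce_into_eqI) (simp_all add: cong_sym)
  then show ?case using Cons by (simp add: add_into_def)
qed

section \<open>The alphabet and its signed parts as progressions\<close>

lemma alphabet_eq_progression: "alphabet q = progression (1 - int q) q"
proof
  show "alphabet q \<subseteq> progression (1 - int q) q"
    by (auto simp: alphabet_def progression_def)
  show "progression (1 - int q) q \<subseteq> alphabet q"
  proof
    fix x assume x: "x \<in> progression (1 - int q) q"
    then obtain d where d: "x - (1 - int q) = 2 * d" unfolding progression_def by blast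
    then have "0 \<le> d" "d < int q" using x by (auto simp: progression_def)
    then have "nat d \<in> {0..<q}" "x = 2 * int (nat d) - (int q - 1)" using d by auto
    then show "x \<in> alphabet q" unfolding alphabet_def by blast
  qed
qed

text \<open>The least symbol of each polarity: symbols are odd for even \<open>q\<close> and even
  for odd \<open>q\<close>, so the least positive one is 1 or 2 respectively.\<close>

fun part_low :: "polarity \<Rightarrow> nat \<Rightarrow> int" where
  "part_low Pos q = 1 + int (q mod 2)"
| "part_low Neg q = 1 - int q"

lemma alphabet_part_eq_progression:
  "alphabet_part \<nu> q = progression (part_low \<nu> q) (floor_half q)"
proof (rule set_eqI)
  fix x
  obtain h where "q = 2 * h \<or> q = 2 * h + 1" by (meson evenE oddE)
  then show "x \<in> alphabet_part \<nu> q \<longleftrightarrow> x \<in> progression (part_low \<nu> q) (floor_half q)"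
    by (induction \<nu>)
      (auto simp: alphabet_part_def alphabet_eq_progression progression_def floor_half_def, presburger+)
qed

lemma ceil_half_eq: "ceil_half q = (int q + 1) div 2"
proof (cases "even q")
  case True
  then obtain h where "q = 2 * h" by blast
  then show ?thesis by (simp add: ceil_half_def)
next
  case False
  then obtain h where h: "q = 2 * h + 1" by (blast elim: oddE)
  have "\<lceil>real q / 2\<rceil> = int h + 1" by (rule ceiling_unique) (auto simp: h)
  then show ?thesis by (simp add: ceil_half_def h)
qed

section \<open>Polarity balancing\<close>

text \<open>A parity count. If every symbol failed, then with n the length of \<open>u\<close> each
  count plus n + 1 would be even. The counts add up to n, so n + q(n + 1) would be even, which is
  false for odd q.\<close>

lemma exists_offset:
  assumes "odd q" "set u \<subseteq> alphabet q"
  shows "\<exists>a \<in> alphabet q. even (count_list u a) \<longleftrightarrow> even (length u)"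
proof (rule ccontr)
  assume "\<not> ?thesis"
  then have neg: "\<forall>a \<in> alphabet q. even (count_list u a + Suc (length u))" by auto
  have fin: "finite (alphabet q)" and card: "card (alphabet q) = q"
    by (auto simp: alphabet_def card_image inj_on_def)
  have "length u = (\<Sum>a \<in> alphabet q. count_list u a)"
    using sum_count_set[OF assms(2) fin] by simp
  moreover have "even (\<Sum>a \<in> alphabet q. count_list u a + Suc (length u))"
    using neg by (intro dvd_sum) auto
  then have "even ((\<Sum>a \<in> alphabet q. count_list u a) + q * Suc (length u))"
    unfolding sum.distrib by (simp only: sum_constant card of_nat_id)
  ultimately have "even (length u + q * Suc (length u))" by simp
  then show False using assms(1) by auto
qed

text \<open>The sum of signs is the number of positive minus the number of negative symbols; unlike
  the two counts, it simply changes sign under negation.\<close>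

lemma polarity_balanced_iff_sgn: "polarity_balanced y \<longleftrightarrow> sum_list (map sgn y) = 0"
proof -
  have "sum_list (map sgn y) = int (length (part Pos y)) - int (length (part Neg y))"
    by (induction y) (auto simp: part_def sgn_if)
  then show ?thesis by (auto simp: polarity_balanced_def)
qed

lemma even_sum_sgn:
  "even (sum_list (map sgn (u :: int list))) \<longleftrightarrow> (even (length u) \<longleftrightarrow> even (count_list u 0))"
  by (induction u) (auto simp: sgn_if)

lemma sum_sgn_negate_first:
  "sum_list (map sgn (negate_first z u)) = sum_list (map sgn u) - 2 * sum_list (map sgn (take z u))"
proof -
  have neg: "sum_list (map sgn (map uminus v)) = - sum_list (map sgn v)" for v :: "int list"
    by (induction v) (auto simp: sgn_minus)
  have "sum_list (map sgn u) = sum_list (map sgn (take z u)) + sum_list (map sgn (drop z u))"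
    by (metis append_take_drop_id map_append sum_list_append)
  then show ?thesis using neg[of "take z u"] by (simp add: negate_first_def)
qed

text \<open>Negating a prefix lowers the sign sum by twice the sign sum of that prefix, so a prefix
  carrying half of the total is wanted. Prefix sums move by at most 1 from 0 to the total
  \<open>2 * h\<close>, and therefore hit \<open>h\<close>.\<close>

lemma exists_pb_index:
  assumes "u \<noteq> []" "even (length u) \<longleftrightarrow> even (count_list u 0)"
  shows "\<exists>z. is_pb_index u z"
proof -
  define G where "G z = sum_list (map sgn (take z u))" for z
  obtain h where h: "sum_list (map sgn u) = 2 * h"
    using assms(2) even_sum_sgn by blast
  have step: "\<bar>G (z + 1) - G z\<bar> \<le> 1" if "z < length u" for z
    using that by (simp add: G_def take_Suc_conv_app_nth sgn_if)
  have "G 0 = 0" "G (length u) = 2 * h" using h by (simp_all add: G_def)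
  have "\<exists>z \<le> length u. G z = h"
  proof (cases "h \<ge> 0")
    case True
    show ?thesis
      by (rule nat0_intermed_int_val)
        (use step True \<open>G 0 = 0\<close> \<open>G (length u) = 2 * h\<close> in auto)
  next
    case False
    \<comment> \<open>The discrete intermediate value theorem needs an upward crossing, hence the
      change of sign.\<close>
    have "\<exists>z \<le> length u. - G z = - h"
      by (rule nat0_intermed_int_val)
        (use step False \<open>G 0 = 0\<close> \<open>G (length u) = 2 * h\<close> in \<open>auto simp: abs_minus_commute\<close>)
    then show ?thesis by simp
  qed
  then obtain z where z: "z \<le> length u" "G z = h" by blast
  show ?thesis
  proof (cases "z = length u")
    \<comment> \<open>The full length is not an admissible index. Here \<open>h = 2 * h\<close>, so
      the sequence is already balanced and index 0 serves.\<close>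
    case True
    then have "h = 0" using z \<open>G (length u) = 2 * h\<close> by simp
    then have "is_pb_index u 0"
      using assms(1) h by (simp add: is_pb_index_def polarity_balanced_iff_sgn negate_first_def)
    then show ?thesis ..
  next
    case False
    then have "is_pb_index u z"
      using z h sum_sgn_negate_first[of z u]
      by (simp add: is_pb_index_def polarity_balanced_iff_sgn G_def)
    then show ?thesis ..
  qed
qed

section \<open>Shifting by the offset\<close>

lemma add_2q_replicate:
  "add_2q q u (replicate (length u) a) =
    map (\<lambda>s. reduce_into (progression (1 - int q) q) (2 * int q) (s + a)) u"
  by (induction u) (auto simp: add_2q_def add_into_def alphabet_eq_progression)

lemma length_shift_seq [simp]: "length (shift_seq q ao u) = length u"
  by (cases ao) (simp_all add: add_2q_replicate)

lemma even_alphabet: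
  assumes "odd q" "x \<in> alphabet q"
  shows "even x"
  using assms by (auto simp: alphabet_def)

lemma is_offsetE:
  assumes "is_offset q u ao"
  obtains "even q" "ao = None"
  | a where "odd q" "ao = Some a" "a \<in> alphabet q" "even (count_list u a) \<longleftrightarrow> even (length u)"
  using assms by (auto simp: is_offset_def split: if_splits)

lemma set_shift_seq:
  assumes "is_offset q u ao" "set u \<subseteq> alphabet q"
  shows "set (shift_seq q ao u) \<subseteq> alphabet q"
  using assms(1)
proof (cases rule: is_offsetE)
  case 1
  then show ?thesis using assms by simp
next
  case (2 a)
  have "reduce_into (progression (1 - int q) q) (2 * int q) (s - a) \<in> alphabet q" if "s \<in> set u" for s
    unfolding alphabet_eq_progression
    using that 2 assms(2) even_alphabet[of q]
    by (intro reduce_into_props(1)) (auto simp: odd_pos)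
  then show ?thesis using 2(2) by (auto simp: add_2q_replicate)
qed

lemma unshift_shift_seq:
  assumes "is_offset q u ao" "set u \<subseteq> alphabet q"
  shows "unshift_seq q ao (shift_seq q ao u) = u"
  using assms(1)
proof (cases rule: is_offsetE)
  case 1
  then show ?thesis by simp
next
  case (2 a)
  let ?xs = "add_2q q u (replicate (length u) (- a))"
  have "unshift_seq q ao (shift_seq q ao u) = add_2q q ?xs (map uminus (replicate (length u) (- a)))"
    using 2(2) by (simp add: add_2q_def)
  also have "\<dots> = u"
    unfolding add_2q_def alphabet_eq_progression
    using 2 assms(2) even_alphabet[of q]
    by (intro add_into_uminus_cancel) (auto simp: alphabet_eq_progression odd_pos)
  finally show ?thesis .
qed

text \<open>Two symbols differ by less than \<open>2 * q\<close>, so only \<open>a\<close> itself is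
  shifted to 0. The parity condition on the offset thus becomes the condition on zeros in
  \<open>exists_pb_index\<close>.\<close>

lemma count_shift_seq:
  assumes "odd q" "a \<in> alphabet q" "set u \<subseteq> alphabet q"
  shows "count_list (shift_seq q (Some a) u) 0 = count_list u a"
proof -
  have zero: "0 \<in> progression (1 - int q) q"
    using assms(1) odd_pos[OF assms(1)] by (auto simp: progression_def)
  have "reduce_into (progression (1 - int q) q) (2 * int q) (s - a) = 0 \<longleftrightarrow> s = a"
    if "s \<in> alphabet q" for s
  proof
    assume "s = a"
    then show "reduce_into (progression (1 - int q) q) (2 * int q) (s - a) = 0"
      using zero by (intro reduce_into_eqI) simp_all
  next
    assume "reduce_into (progression (1 - int q) q) (2 * int q) (s - a) = 0"
    moreover have "[reduce_into (progression (1 - int q) q) (2 * int q) (s - a) = s - a] (mod (2 * int q))"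
      using that assms even_alphabet[of q] by (intro reduce_into_props(2)) (auto simp: odd_pos)
    ultimately have "2 * int q dvd s - a" using cong_0_iff cong_sym by metis
    moreover have "\<bar>s - a\<bar> < 2 * int q"
      using that assms(2) by (auto simp: alphabet_def)
    ultimately show "s = a" using zdvd_not_zless[of "\<bar>s - a\<bar>" "2 * int q"] by fastforce
  qed
  then have "count_list (map (\<lambda>s. reduce_into (progression (1 - int q) q) (2 * int q) (s - a)) u) 0
      = count_list u a"
    using assms(3) by (induction u) auto
  then show ?thesis by (simp add: add_2q_replicate)
qed

lemma exists_pb_index_shift:
  assumes "is_offset q u ao" "set u \<subseteq> alphabet q" "u \<noteq> []" "even q \<Longrightarrow> even (length u)"
  shows "\<exists>z. is_pb_index (shift_seq q ao u) z"
proof (rule exists_pb_index)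
  show "shift_seq q ao u \<noteq> []" using assms(3) by (metis length_0_conv length_shift_seq)
  show "even (length (shift_seq q ao u)) \<longleftrightarrow> even (count_list (shift_seq q ao u) 0)"
    using assms(1)
  proof (cases rule: is_offsetE)
    case 1
    \<comment> \<open>For even \<open>q\<close> all symbols are odd.\<close>
    then have "0 \<notin> set u" using assms(2) using 1
      by (fastforce simp: alphabet_eq_progression progression_def)
    then show ?thesis using 1 assms(4) by (simp add: count_notin)
  next
    case (2 a)
    then show ?thesis using assms(2) count_shift_seq[of q a u] by (simp del: shift_seq.simps)
  qed
qed

lemma length_negate_first [simp]: "length (negate_first z u) = length u"
  by (simp add: negate_first_def)

lemma negate_first_negate_first [simp]: "negate_first z (negate_first z u) = u"
  by (simp add: negate_first_def o_def min_def)

lemma alphabet_uminus: "x \<in> alphabet q \<Longrightarrow> - x \<in> alphabet q"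
  by (auto simp: alphabet_eq_progression progression_def) presburger+

lemma set_negate_first: "set u \<subseteq> alphabet q \<Longrightarrow> set (negate_first z u) \<subseteq> alphabet q"
  using set_take_subset[of z u] set_drop_subset[of z u]
  by (auto simp: negate_first_def intro!: alphabet_uminus)

lemma pb_decode_encode:
  assumes "is_offset q u ao" "set u \<subseteq> alphabet q"
  shows "pb_decode q ao z (pb_encode q ao z u) = u"
  using assms by (simp add: pb_decode_def pb_encode_def unshift_shift_seq)

section \<open>Existence of the index \<open>w\<close>\<close>

text \<open>\<open>F\<close> may drop arbitrarily far but rises by at most one, so it cannot jump
  over \<open>c\<close> on its way up.\<close>

lemma up_crossing:
  fixes F :: "nat \<Rightarrow> nat"
  assumes "a \<le> b" "\<And>i. F (Suc i) \<le> Suc (F i)" "F a \<le> c" "c \<le> F b"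
  shows "\<exists>i \<in> {a..b}. F i = c"
  using assms(1,4)
proof (induction b rule: dec_induct)
  case base
  then show ?case using assms(3) by auto
next
  case (step n)
  show ?case
  proof (cases "c \<le> F n")
    case True
    then show ?thesis using step by force
  next
    case False
    then have "F (Suc n) = c" using step.prems assms(2)[of n] by simp
    then show ?thesis using step.hyps by force
  qed
qed

section \<open>Sums over one period of the index\<close>

lemma sum_mod_shift: "(\<Sum>j<n. (a + j) mod n) = (\<Sum>j<n. j)" for n :: nat
proof (induction a)
  case (Suc a)
  \<comment> \<open>Moving the window by one trades the term \<open>a mod n\<close> for
    \<open>(a + n) mod n\<close>, which is the same number.\<close>
  have "(\<Sum>j<n. (Suc a + j) mod n) + a mod n = (\<Sum>j<Suc n. (a + j) mod n)"
    by (simp only: sum.lessThan_Suc_shift) simp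
  then show ?case using Suc by simp
qed simp

text \<open>Symbols of one polarity are two apart, so this counts places: adding the i-th sequence
  moves position \<open>l\<close> this many places along the cycle of \<open>n\<close>
  symbols.\<close>

definition b_count :: "nat \<Rightarrow> nat \<Rightarrow> nat \<Rightarrow> nat" where
  "b_count K i l = i div K + (if l < i mod K then 1 else 0)"

lemma b_seq_eq: "b_seq K i = map (\<lambda>l. 2 * int (b_count K i l)) [0..<K]" if "K > 0"
proof (rule nth_equalityI)
  have g: "i - K * (i div K) = i mod K" by (simp add: minus_mult_div_eq_mod)
  have less: "i mod K < K" using that by simp
  then show "length (b_seq K i) = length (map (\<lambda>l. 2 * int (b_count K i l)) [0..<K])"
    by (simp add: b_seq_def g Let_def)
  fix l assume "l < length (b_seq K i)"
  then have "l < K" using less by (simp add: b_seq_def g Let_def)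
  then show "b_seq K i ! l = map (\<lambda>l. 2 * int (b_count K i l)) [0..<K] ! l"
    using less by (auto simp: b_seq_def g Let_def nth_append b_count_def)
qed

lemma even_b_seq: "t \<in> set (b_seq K i) \<Longrightarrow> even t"
  by (auto simp: b_seq_def Let_def)

lemma length_b_seq: "K > 0 \<Longrightarrow> length (b_seq K i) = K"
  by (simp add: b_seq_eq)

text \<open>Each increment of \<open>i\<close> advances exactly one position; when that is the last
  one, the quotient grows and the remainder restarts at 0.\<close>

lemma b_count_Suc:
  assumes "l < K"
  shows "b_count K (Suc i) l = b_count K i l + (if l = i mod K then 1 else 0)"
  using assms by (auto simp: b_count_def div_Suc mod_Suc)

text \<open>Write \<open>i\<close> as \<open>g + j * K\<close>. For a fixed remainder
  \<open>g\<close> the quotient \<open>j\<close> runs once through all residues modulo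
  \<open>n\<close>, whatever the starting value.\<close>

lemma sum_b_count_mod:
  assumes "l < K"
  shows "(\<Sum>i<n * K. (a + b_count K i l) mod n) = K * (\<Sum>j<n. j)"
proof -
  have "(\<Sum>i<n * K. (a + b_count K i l) mod n) =
      (\<Sum>j<n. \<Sum>g<K. (a + b_count K (g + j * K) l) mod n)"
    using sum.nat_group[of "\<lambda>i. (a + b_count K i l) mod n" K n]
      sum.shift_bounds_nat_ivl[of "\<lambda>i. (a + b_count K i l) mod n" 0 "_ * K" K]
    by (simp add: lessThan_atLeast0 add.commute)
  also have "\<dots> = (\<Sum>j<n. \<Sum>g<K. (a + (if l < g then 1 else 0) + j) mod n)"
    using assms by (intro sum.cong) (auto simp: b_count_def add_ac)
  also have "\<dots> = (\<Sum>g<K. \<Sum>j<n. (a + (if l < g then 1 else 0) + j) mod n)"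
    by (rule sum.swap)
  also have "\<dots> = K * (\<Sum>j<n. j)" by (simp only: sum_mod_shift) simp
  finally show ?thesis .
qed

text \<open>
  One step of \<open>i\<close> raises the sum by at most one, a full period returns it to its start, and its
  average over the period is \<open>K * (n - 1) / 2\<close>. Hence every value between the start and the
  average is attained: on the way up to an index with at least average sum, or on the way back
  up from an index with at most average sum.
\<close>

lemma exists_sum_mod_eq:
  fixes a :: "nat \<Rightarrow> nat" and n K c :: nat
  defines "F \<equiv> \<lambda>i. \<Sum>l<K. (a l + b_count K i l) mod n"
  assumes "n > 0" "K > 0"
    and "F 0 \<ge> c \<and> 2 * c \<ge> K * (n - 1) \<or> F 0 \<le> c \<and> 2 * c \<le> K * (n - 1)"
  shows "\<exists>i < n * K. F i = c"
proof -
  have up: "F (Suc i) \<le> Suc (F i)" for i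
  proof -
    have "F (Suc i) \<le> (\<Sum>l<K. (a l + b_count K i l) mod n + (if l = i mod K then 1 else 0))"
      unfolding F_def
    \<comment> \<open>Only an inequality holds, since the advancing position may wrap from
      \<open>n - 1\<close> to 0.\<close>
    proof (rule sum_mono)
      fix l assume "l \<in> {..<K}"
      then show "(a l + b_count K (Suc i) l) mod n
          \<le> (a l + b_count K i l) mod n + (if l = i mod K then 1 else 0)"
        by (auto simp: b_count_Suc mod_Suc)
    qed
    also have "\<dots> = Suc (F i)" using \<open>K > 0\<close> by (simp add: sum.distrib F_def)
    finally show ?thesis .
  qed
  have period: "F (n * K) = F 0" using \<open>K > 0\<close> by (simp add: F_def b_count_def)
  have "(\<Sum>i<n * K. F i) = (\<Sum>l<K. \<Sum>i<n * K. (a l + b_count K i l) mod n)"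
    unfolding F_def by (rule sum.swap)
  also have "\<dots> = K * (K * (\<Sum>j<n. j))" by (simp add: sum_b_count_mod)
  finally have "(\<Sum>i<n * K. 2 * F i) = K * (K * (2 * (\<Sum>j<n. j)))"
    by (simp add: sum_distrib_left[symmetric])
  also have "2 * (\<Sum>j<n. j) = n * (n - 1)"
  proof (induction n)
    case (Suc m)
    then show ?case by (cases m) (simp_all add: algebra_simps)
  qed simp
  \<comment> \<open>Sums are doubled to keep the average \<open>K * (n - 1) / 2\<close> within the
    natural numbers.\<close>
  finally have total: "(\<Sum>i<n * K. 2 * F i) = (\<Sum>i<n * K. K * (n - 1))" by simp
  have ne: "{..<n * K} \<noteq> {}" using assms(2,3) lessThan_empty_iff[of "n * K"] by simp
  from assms(4) show ?thesis
  proof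
    assume c: "F 0 \<ge> c \<and> 2 * c \<ge> K * (n - 1)"
    \<comment> \<open>If all values exceeded the average, so would their total.\<close>
    obtain i where i: "i < n * K" "2 * F i \<le> K * (n - 1)"
      using sum_strict_mono[of "{..<n * K}" "\<lambda>_. K * (n - 1)" "\<lambda>i. 2 * F i"] total ne
      by (metis finite_lessThan lessThan_iff less_irrefl not_le)
    then obtain i' where i': "i' \<in> {i..n * K}" "F i' = c"
      using up_crossing[of i "n * K" F c] up period c by auto
    show ?thesis
    proof (cases "i' = n * K")
      \<comment> \<open>\<open>n * K\<close> lies just outside the range, but by periodicity index 0
        has the same sum.\<close>
      case True
      then show ?thesis using i' period assms(2,3) by (intro exI[of _ 0]) auto
    next
      case False
      then show ?thesis using i' by (intro exI[of _ i']) auto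
    qed
  next
    assume c: "F 0 \<le> c \<and> 2 * c \<le> K * (n - 1)"
    obtain i where i: "i < n * K" "2 * F i \<ge> K * (n - 1)"
      using sum_strict_mono[of "{..<n * K}" "\<lambda>i. 2 * F i" "\<lambda>_. K * (n - 1)"] total ne
      by (metis finite_lessThan lessThan_iff less_irrefl not_le)
    then obtain i' where "i' \<in> {0..i}" "F i' = c"
      using up_crossing[of 0 i F c] up c by auto
    then show ?thesis using i(1) by (intro exI[of _ i']) auto
  qed
qed

text \<open>Numbering the symbols by their place in the progression turns the sum into
  \<open>K * lo + 2 * F w\<close> and its midpoint \<open>lo + n - 1\<close> into the average place,
  so \<open>exists_sum_mod_eq\<close> applies to half of \<open>T - K * lo\<close>.\<close>

lemma exists_shift_index:
  assumes "n > 0" "rs \<noteq> []" "set rs \<subseteq> progression lo n"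
    and "even (T - int (length rs) * lo)"
    and avg: "sum_list rs \<ge> T \<and> T \<ge> int (length rs) * (lo + int n - 1) \<or>
      sum_list rs \<le> T \<and> T \<le> int (length rs) * (lo + int n - 1)"
  shows "\<exists>w < n * length rs.
    sum_list (add_into (progression lo n) (2 * int n) rs (b_seq (length rs) w)) = T"
proof -
  define K where "K = length rs"
  define a where "a l = nat ((rs ! l - lo) div 2)" for l
  define F where "F i = (\<Sum>l<K. (a l + b_count K i l) mod n)" for i
  have K: "K > 0" using assms(2) by (simp add: K_def)
  have rs: "rs ! l = lo + 2 * int (a l)" "a l < n" if "l < K" for l
  proof -
    have "rs ! l \<in> progression lo n" using that assms(3) by (auto simp: K_def)
    then show "rs ! l = lo + 2 * int (a l)" "a l < n"
      by (auto simp: progression_def a_def)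
  qed
  have sum: "sum_list (add_into (progression lo n) (2 * int n) rs (b_seq K w)) =
      int K * lo + 2 * int (F w)" for w
  proof -
    have red: "reduce_into (progression lo n) (2 * int n) (rs ! l + b_seq K w ! l) =
        lo + 2 * int ((a l + b_count K w l) mod n)" if "l < K" for l
    proof -
      have eq: "rs ! l + b_seq K w ! l = lo + 2 * int (a l + b_count K w l)"
        using that K by (simp add: rs b_seq_eq)
      show ?thesis unfolding eq
        using assms(1) by (subst reduce_into_progression) (simp_all add: mult_mod_right zmod_int)
    qed
    have "sum_list (add_into (progression lo n) (2 * int n) rs (b_seq K w)) =
        (\<Sum>l<K. reduce_into (progression lo n) (2 * int n) (rs ! l + b_seq K w ! l))"
      using K by (simp add: sum_list_sum_nth add_into_def length_b_seq K_def lessThan_atLeast0)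
    also have "\<dots> = (\<Sum>l<K. lo + 2 * int ((a l + b_count K w l) mod n))"
      by (intro sum.cong) (simp_all add: red)
    also have "\<dots> = int K * lo + 2 * int (F w)"
      by (simp add: sum.distrib F_def sum_distrib_left)
    finally show ?thesis .
  qed
  have start: "sum_list rs = int K * lo + 2 * int (F 0)"
  proof -
    have "sum_list rs = (\<Sum>l<K. rs ! l)"
      by (simp add: sum_list_sum_nth K_def lessThan_atLeast0)
    also have "\<dots> = (\<Sum>l<K. lo + 2 * int ((a l + b_count K 0 l) mod n))"
      by (intro sum.cong) (auto simp: rs b_count_def)
    also have "\<dots> = int K * lo + 2 * int (F 0)"
      by (simp add: sum.distrib F_def sum_distrib_left)
    finally show ?thesis .
  qed
  obtain d where d: "T = int K * lo + 2 * d"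
    using assms(4) unfolding K_def by (metis add_diff_cancel_left' diff_add_cancel add.commute evenE)
  have mean: "int K * (lo + int n - 1) = int K * lo + int (K * (n - 1))"
    using assms(1) by (simp add: algebra_simps of_nat_diff)
  \<comment> \<open>\<open>T\<close> is bounded below either by the mean or by
    \<open>sum_list rs\<close>, and both are at least \<open>K * lo\<close>.\<close>
  have "d \<ge> 0"
    using avg start d mean unfolding K_def[symmetric] by linarith
  then obtain c where c: "d = int c" using nonneg_int_cases by blast
  have "F 0 \<ge> c \<and> 2 * c \<ge> K * (n - 1) \<or> F 0 \<le> c \<and> 2 * c \<le> K * (n - 1)"
    using avg start d mean c unfolding K_def[symmetric] by linarith
  then obtain w where "w < n * K" "F w = c"
    using exists_sum_mod_eq[of n K c a] assms(1) K unfolding F_def by blast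
  then show ?thesis using sum d c unfolding K_def by auto
qed

section \<open>Replacing and reflecting parts\<close>

text \<open>The new symbols keep the polarity of the old ones, so the replaced positions can be
  recognised afterwards and the replacement undone. A single induction proves all claims, as each
  follows the same consumption of \<open>vs\<close>.\<close>

lemma replace_part_props:
  assumes "length vs = length (part \<nu> y)" "\<forall>v \<in> set vs. has_polarity \<nu> v"
  shows part_replace_part: "part \<nu> (replace_part \<nu> y vs) = vs"
    and part_opposite_replace_part:
      "part (opposite \<nu>) (replace_part \<nu> y vs) = part (opposite \<nu>) y"
    and length_replace_part: "length (replace_part \<nu> y vs) = length y"
    and set_replace_part: "set (replace_part \<nu> y vs) \<subseteq> set y \<union> set vs"
    and replace_part_replace_part: "replace_part \<nu> (replace_part \<nu> y vs) (part \<nu> y) = y"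
proof -
  have opp: "has_polarity \<nu> v \<Longrightarrow> \<not> has_polarity (opposite \<nu>) v" for v by (cases \<nu>) auto
  have "part \<nu> (replace_part \<nu> y vs) = vs \<and>
    part (opposite \<nu>) (replace_part \<nu> y vs) = part (opposite \<nu>) y \<and>
    length (replace_part \<nu> y vs) = length y \<and>
    set (replace_part \<nu> y vs) \<subseteq> set y \<union> set vs \<and>
    replace_part \<nu> (replace_part \<nu> y vs) (part \<nu> y) = y"
    using assms
  proof (induction y arbitrary: vs)
    case Nil
    then show ?case by (simp add: part_def)
  next
    case (Cons s ss)
    show ?case
    proof (cases "has_polarity \<nu> s")
      case True
      then obtain v vs' where vs: "vs = v # vs'"
        using Cons.prems by (cases vs) (auto simp: part_def)
      then show ?thesis using True Cons.prems Cons.IH[of vs'] opp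
        by (auto simp: part_def)
    next
      case False
      then show ?thesis using Cons.prems Cons.IH[of vs]
        by (auto simp: part_def)
    qed
  qed
  then show "part \<nu> (replace_part \<nu> y vs) = vs"
    "part (opposite \<nu>) (replace_part \<nu> y vs) = part (opposite \<nu>) y"
    "length (replace_part \<nu> y vs) = length y"
    "set (replace_part \<nu> y vs) \<subseteq> set y \<union> set vs"
    "replace_part \<nu> (replace_part \<nu> y vs) (part \<nu> y) = y" by auto
qed

lemma sum_list_parts: "sum_list y = sum_list (part Pos y) + sum_list (part Neg y)"
  by (induction y) (auto simp: part_def)

text \<open>The least and the greatest positive symbol add up to \<open>2 * ceil_half q\<close>, so
  the map reverses the positive symbols.\<close>

lemma alphabet_reflect:
  assumes "s \<in> alphabet q" "s > 0"
  shows "2 * ceil_half q - s \<in> alphabet q" "2 * ceil_half q - s > 0"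
proof -
  have "(2 * ceil_half q - s \<in> alphabet q) \<and> 2 * ceil_half q - s > 0"
    using assms unfolding ceil_half_eq alphabet_eq_progression progression_def
    by simp presburger
  then show "2 * ceil_half q - s \<in> alphabet q" "2 * ceil_half q - s > 0" by auto
qed

lemma reflect_pos_props:
  assumes "set y \<subseteq> alphabet q"
  shows set_reflect_pos: "set (reflect_pos q \<xi> y) \<subseteq> alphabet q"
    and length_reflect_pos: "length (reflect_pos q \<xi> y) = length y"
    and length_part_reflect_pos: "length (part \<nu> (reflect_pos q \<xi> y)) = length (part \<nu> y)"
    and sum_pos_reflect_pos: "sum_list (part Pos (reflect_pos q \<xi> y)) =
      (if \<xi> = 1 then 2 * int (length (part Pos y)) * ceil_half q - sum_list (part Pos y)
       else sum_list (part Pos y))"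
    and sum_neg_reflect_pos: "sum_list (part Neg (reflect_pos q \<xi> y)) = sum_list (part Neg y)"
    and reflect_pos_reflect_pos: "reflect_pos q \<xi> (reflect_pos q \<xi> y) = y"
proof -
  have "set (reflect_pos q \<xi> y) \<subseteq> alphabet q \<and>
    length (reflect_pos q \<xi> y) = length y \<and>
    length (part Pos (reflect_pos q \<xi> y)) = length (part Pos y) \<and>
    length (part Neg (reflect_pos q \<xi> y)) = length (part Neg y) \<and>
    sum_list (part Pos (reflect_pos q \<xi> y)) =
      (if \<xi> = 1 then 2 * int (length (part Pos y)) * ceil_half q - sum_list (part Pos y)
       else sum_list (part Pos y)) \<and>
    sum_list (part Neg (reflect_pos q \<xi> y)) = sum_list (part Neg y) \<and>
    reflect_pos q \<xi> (reflect_pos q \<xi> y) = y"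
  proof (cases "\<xi> = 1")
    case True
    from assms show ?thesis
    proof (induction y)
      case Nil
      then show ?case by (simp add: reflect_pos_def part_def)
    next
      case (Cons s ss)
      then show ?case using True alphabet_reflect[of s q]
        by (cases "s > 0") (simp_all add: reflect_pos_def part_def algebra_simps)
    qed
  next
    case False
    then show ?thesis using assms by (simp add: reflect_pos_def)
  qed
  then show "set (reflect_pos q \<xi> y) \<subseteq> alphabet q"
    "length (reflect_pos q \<xi> y) = length y"
    "length (part \<nu> (reflect_pos q \<xi> y)) = length (part \<nu> y)"
    "sum_list (part Pos (reflect_pos q \<xi> y)) =
      (if \<xi> = 1 then 2 * int (length (part Pos y)) * ceil_half q - sum_list (part Pos y)
       else sum_list (part Pos y))"
    "sum_list (part Neg (reflect_pos q \<xi> y)) = sum_list (part Neg y)"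
    "reflect_pos q \<xi> (reflect_pos q \<xi> y) = y" by (cases \<nu>; simp)+
qed

lemma set_part:
  assumes "set y \<subseteq> alphabet q"
  shows "set (part \<nu> y) \<subseteq> progression (part_low \<nu> q) (floor_half q)"
  using assms unfolding alphabet_part_eq_progression[symmetric]
  by (auto simp: part_def alphabet_part_def)

section \<open>Charge and polarity balancing\<close>

text \<open>The left side is the midpoint of the progression of symbols of polarity \<nu>; this
  links the threshold in \<open>xi\<close> and \<open>nu\<close> to the average in
  \<open>exists_shift_index\<close>.\<close>

lemma part_mean: "part_low \<nu> q + int (floor_half q) - 1 =
  (case \<nu> of Pos \<Rightarrow> ceil_half q | Neg \<Rightarrow> - ceil_half q)"
  by (cases \<nu>) (simp_all add: ceil_half_eq floor_half_def, presburger+)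

text \<open>All symbols share one parity, so the target sum has the parity that sums of
  \<open>K\<close> symbols of polarity \<nu> have.\<close>

lemma even_sum_part:
  assumes "set y \<subseteq> alphabet q" "length (part (opposite \<nu>) y) = K"
  shows "even (- sum_list (part (opposite \<nu>) y) - int K * part_low \<nu> q)"
proof -
  have low: "even (part_low \<nu> q - (1 - int q))" by (cases \<nu>) simp_all
  have "even (sum_list v - int (length v) * part_low \<nu> q)" if "set v \<subseteq> alphabet q" for v
    using that
  proof (induction v)
    case (Cons s v)
    then have "even (s - (1 - int q))" by (auto simp: alphabet_eq_progression progression_def)
    then have "even (s - part_low \<nu> q)" using low by presburger
    then have "even ((s - part_low \<nu> q) + (sum_list v - int (length v) * part_low \<nu> q))"
      using Cons by (intro dvd_add) auto
    then show ?case by (simp add: algebra_simps)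
  qed simp
  from this[of "part (opposite \<nu>) y"] show ?thesis
    using assms by (force simp: part_def)
qed

lemma exists_w_index:
  assumes "q \<ge> 2" "set y \<subseteq> alphabet q" "polarity_balanced y"
  defines "K \<equiv> length (part Pos y)"
  defines "zs \<equiv> reflect_pos q (xi q y) y"
  shows "\<exists>w. is_w_index q K (nu q K zs) zs w"
proof -
  define \<nu> where "\<nu> = nu q K zs"
  have zs: "set zs \<subseteq> alphabet q" unfolding zs_def by (rule set_reflect_pos[OF assms(2)])
  have len: "length (part \<mu> zs) = K" for \<mu>
    using assms(3) unfolding zs_def K_def polarity_balanced_def length_part_reflect_pos[OF assms(2)]
    by (cases \<mu>) simp_all
  show ?thesis
  proof (cases "K = 0")
    case True
    then have nil: "part \<mu> zs = []" for \<mu> using len[of \<mu>] by (simp only: length_0_conv)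
    have "is_w_index q K \<nu> zs 0"
      unfolding True is_w_index_def w_range_def add_pol_def add_into_def nil by simp
    then show ?thesis unfolding \<nu>_def ..
  next
    case False
    let ?c = "ceil_half q" and ?P = "sum_list (part Pos zs)" and ?N = "- sum_list (part Neg zs)"
    \<comment> \<open>\<open>xi\<close> is 1 exactly when the sums lie strictly on opposite sides of
      the mean \<open>m\<close>; reflection then maps \<open>P\<close> to \<open>2 * m - P\<close>,
      on the side of \<open>N\<close>.\<close>
    have same_side: "(?P \<ge> int K * ?c \<and> ?N \<ge> int K * ?c) \<or> (?P \<le> int K * ?c \<and> ?N \<le> int K * ?c)"
    proof -
      define P N m where "P = sum_list (part Pos y)" and "N = - sum_list (part Neg y)"
        and "m = int K * ?c"
      have "?N = N" unfolding zs_def N_def sum_neg_reflect_pos[OF assms(2)] ..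
      moreover have "?P = (if xi q y = 1 then 2 * m - P else P)"
        unfolding zs_def P_def m_def K_def sum_pos_reflect_pos[OF assms(2)] by (simp only: mult.assoc)
      moreover have "xi q y = (if P < m \<and> m < N \<or> N < m \<and> m < P then 1 else 0)"
        unfolding xi_def P_def N_def m_def K_def Let_def ..
      ultimately show ?thesis unfolding m_def[symmetric]
        by (cases "P < m \<and> m < N \<or> N < m \<and> m < P") auto
    qed
    have between: "sum_list (part \<nu> zs) \<ge> - sum_list (part (opposite \<nu>) zs) \<and>
        - sum_list (part (opposite \<nu>) zs) \<ge> int K * (part_low \<nu> q + int (floor_half q) - 1) \<or>
      sum_list (part \<nu> zs) \<le> - sum_list (part (opposite \<nu>) zs) \<and>
        - sum_list (part (opposite \<nu>) zs) \<le> int K * (part_low \<nu> q + int (floor_half q) - 1)"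
    proof (cases \<nu>)
      case Pos
      then have "?P \<ge> ?N \<and> ?N \<ge> int K * ?c \<or> ?P \<le> ?N \<and> ?N \<le> int K * ?c"
        unfolding \<nu>_def nu_def Let_def by (meson polarity.distinct)
      then show ?thesis unfolding part_mean using Pos by simp
    next
      case Neg
      then have "\<not> (?P \<ge> ?N \<and> ?N \<ge> int K * ?c \<or> ?P \<le> ?N \<and> ?N \<le> int K * ?c)"
        unfolding \<nu>_def nu_def Let_def by (meson polarity.distinct)
      \<comment> \<open>With both sums on one side of the mean, failure of the condition for
        \<open>Pos\<close> leaves \<open>N\<close> at least as far out as \<open>P\<close>; negation
        reverses the inequalities.\<close>
      then have "sum_list (part Neg zs) \<ge> - ?P \<and> - ?P \<ge> - (int K * ?c) \<or>
          sum_list (part Neg zs) \<le> - ?P \<and> - ?P \<le> - (int K * ?c)"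
        using same_side by linarith
      then show ?thesis unfolding part_mean using Neg by simp
    qed
    have "\<exists>w < floor_half q * length (part \<nu> zs).
      sum_list (add_into (progression (part_low \<nu> q) (floor_half q)) (2 * int (floor_half q))
        (part \<nu> zs) (b_seq (length (part \<nu> zs)) w)) = - sum_list (part (opposite \<nu>) zs)"
    proof (rule exists_shift_index)
      show "floor_half q > 0" using assms(1) by (simp add: floor_half_def)
      show "part \<nu> zs \<noteq> []" using len[of \<nu>] False by auto
      show "set (part \<nu> zs) \<subseteq> progression (part_low \<nu> q) (floor_half q)" by (rule set_part[OF zs])
      show "even (- sum_list (part (opposite \<nu>) zs) - int (length (part \<nu> zs)) * part_low \<nu> q)"
        unfolding len by (rule even_sum_part[OF zs len])
    qed (use between in \<open>simp only: len\<close>)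
    then show ?thesis
      using False unfolding is_w_index_def w_range_def add_pol_def alphabet_part_eq_progression len \<nu>_def[symmetric]
      by auto
  qed
qed

section \<open>Balance and decoding of the encoded sequence\<close>

lemma w_index_props:
  assumes "q \<ge> 2" "set zs \<subseteq> alphabet q" "\<And>\<mu>. length (part \<mu> zs) = K"
    and w: "is_w_index q K \<nu> zs w"
  defines "xs \<equiv> add_w q K \<nu> w zs"
  shows add_w_in_cpb_seqs: "xs \<in> cpb_seqs q (length zs)"
    and length_part_add_w: "length (part \<mu> xs) = K"
    and sub_w_add_w: "sub_w q K \<nu> w xs = zs"
proof -
  define vs where "vs = add_pol q \<nu> (part \<nu> zs) (b_seq K w)"
  have f: "floor_half q > 0" using assms(1) by (simp add: floor_half_def)
  have lenb: "length (b_seq K w) = K"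
  proof (cases "K = 0")
    \<comment> \<open>For \<open>K = 0\<close> the range forces \<open>w = 0\<close>;
      \<open>b_seq 0 i\<close> has length \<open>i\<close>, so only this index fits.\<close>
    case True
    then show ?thesis using w by (simp add: is_w_index_def w_range_def b_seq_def)
  next
    case False
    then show ?thesis by (simp add: length_b_seq)
  qed
  have vs: "length vs = length (part \<nu> zs)" using lenb assms(3) by (simp add: vs_def add_pol_def)
  have "set vs \<subseteq> alphabet_part \<nu> q"
    unfolding vs_def add_pol_def alphabet_part_eq_progression
    using f set_part[OF assms(2)] even_b_seq by (intro add_into_subset) auto
  then have pol: "\<forall>v \<in> set vs. has_polarity \<nu> v" and alph: "set vs \<subseteq> alphabet q"
    by (auto simp: alphabet_part_def)
  have xs: "xs = replace_part \<nu> zs vs" by (simp add: xs_def add_w_def vs_def)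
  have parts: "part \<nu> xs = vs" "part (opposite \<nu>) xs = part (opposite \<nu>) zs"
    unfolding xs using part_replace_part part_opposite_replace_part vs pol by blast+
  have "length (part \<nu> xs) = K" "length (part (opposite \<nu>) xs) = K"
    using parts vs assms(3) by simp_all
  then have len: "length (part Pos xs) = K" "length (part Neg xs) = K" by (cases \<nu>; simp)+
  then show "length (part \<mu> xs) = K" by (cases \<mu>) simp_all
  have "sum_list (part \<nu> xs) + sum_list (part (opposite \<nu>) xs) = 0"
    using w parts by (simp add: is_w_index_def vs_def)
  then have "sum_list xs = 0" unfolding sum_list_parts[of xs] by (cases \<nu>) simp_all
  moreover have "set xs \<subseteq> alphabet q" "length xs = length zs"
    unfolding xs using set_replace_part[OF vs pol] length_replace_part[OF vs pol] alph assms(2) by auto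
  ultimately show "xs \<in> cpb_seqs q (length zs)"
    using len by (simp add: cpb_seqs_def seqs_def charge_balanced_def polarity_balanced_def)
  have "add_pol q \<nu> vs (map uminus (b_seq K w)) = part \<nu> zs"
    unfolding vs_def add_pol_def alphabet_part_eq_progression
    using f set_part[OF assms(2)] even_b_seq assms(3) lenb by (intro add_into_uminus_cancel) auto
  then show "sub_w q K \<nu> w xs = zs"
    using parts replace_part_replace_part[OF vs pol] by (simp add: sub_w_def xs)
qed

lemma pb_encode_props:
  assumes "is_offset q u ao" "is_pb_index (shift_seq q ao u) z" "u \<in> seqs q k"
  shows "set (pb_encode q ao z u) \<subseteq> alphabet q" "length (pb_encode q ao z u) = k"
    "polarity_balanced (pb_encode q ao z u)"
  using assms set_negate_first[OF set_shift_seq[OF assms(1)]]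
  by (auto simp: pb_encode_def seqs_def is_pb_index_def)

lemma cpb_encoding_props:
  assumes "q \<ge> 2" "u \<in> seqs q k" "cpb_encoding q u (ao, z, \<xi>, \<nu>, w) xs"
  shows cpb_encoding_in_cpb_seqs: "xs \<in> cpb_seqs q k"
    and cpb_encoding_decode:
      "pb_decode q ao z (reflect_pos q \<xi> (sub_w q (length (part Pos xs)) \<nu> w xs)) = u"
proof -
  define y zs K where "y = pb_encode q ao z u" and "zs = reflect_pos q \<xi> y"
    and "K = length (part Pos y)"
  have enc: "is_offset q u ao" "is_pb_index (shift_seq q ao u) z"
      "is_w_index q K \<nu> zs w" "xs = add_w q K \<nu> w zs"
    using assms(3) unfolding cpb_encoding_def prod.case Let_def y_def zs_def K_def by blast+
  note y = pb_encode_props[OF enc(1,2) assms(2), folded y_def]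
  have len: "length (part \<mu> zs) = K" for \<mu>
    using y(3) unfolding zs_def K_def polarity_balanced_def length_part_reflect_pos[OF y(1)]
    by (cases \<mu>) simp_all
  have zs: "set zs \<subseteq> alphabet q" "length zs = k"
    unfolding zs_def using y set_reflect_pos length_reflect_pos by auto
  note props = w_index_props[OF assms(1) zs(1) len enc(3), folded enc(4)]
  show "xs \<in> cpb_seqs q k" using props(1) zs(2) by simp
  show "pb_decode q ao z (reflect_pos q \<xi> (sub_w q (length (part Pos xs)) \<nu> w xs)) = u"
    \<comment> \<open>The number of positive symbols is unchanged by encoding, so the decoder reads
      the correct \<open>K\<close> off \<open>xs\<close>; the steps are then undone in reverse
      order.\<close>
    unfolding props(2) props(3) zs_def reflect_pos_reflect_pos[OF y(1)]
    unfolding y_def using pb_decode_encode[OF enc(1)] assms(2) by (simp add: seqs_def)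
qed

lemma append_in_cpb_seqs:
  "p \<in> cpb_seqs q m \<Longrightarrow> x \<in> cpb_seqs q n \<Longrightarrow> p @ x \<in> cpb_seqs q (m + n)"
  by (auto simp: cpb_seqs_def seqs_def charge_balanced_def polarity_balanced_def part_def)

theorem mainTheorem10:
  fixes q k :: nat
  assumes "q \<ge> 4" and "k > 0" and "even q \<Longrightarrow> even k"
  shows "\<forall>u \<in> seqs q k.
    (\<exists>ao. is_offset q u ao) \<and>
    (\<forall>ao. is_offset q u ao \<longrightarrow> (\<exists>z. is_pb_index (shift_seq q ao u) z)) \<and>
    (\<forall>ao z. is_offset q u ao \<and> is_pb_index (shift_seq q ao u) z \<longrightarrow>
       (let y = pb_encode q ao z u; k' = length (part Pos y);
            zs = reflect_pos q (xi q y) y; \<nu> = nu q k' zs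
        in \<exists>w. is_w_index q k' \<nu> zs w)) \<and>
    (\<forall>t xs. cpb_encoding q u t xs \<longrightarrow>
       sum_list (part Pos xs) + sum_list (part Neg xs) = 0 \<and>
       xs \<in> cpb_seqs q k \<and>
       (\<forall>p \<phi>. prefix_map q k p \<phi> \<longrightarrow>
          \<phi> t @ xs \<in> cpb_seqs q (p + k) \<and>
          cpb_decode q k p \<phi> (\<phi> t @ xs) = u))"
proof (intro ballI conjI allI impI)
  fix u assume u: "u \<in> seqs q k"
  have q2: "q \<ge> 2" using assms(1) by simp
  show "\<exists>ao. is_offset q u ao"
    using exists_offset[of q u] u by (auto simp: is_offset_def seqs_def)
  show "\<exists>z. is_pb_index (shift_seq q ao u) z" if "is_offset q u ao" for ao
    using that u assms(2,3) by (intro exists_pb_index_shift) (auto simp: seqs_def)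
  show "let y = pb_encode q ao z u; k' = length (part Pos y);
            zs = reflect_pos q (xi q y) y; \<nu> = nu q k' zs
        in \<exists>w. is_w_index q k' \<nu> zs w"
    if "is_offset q u ao \<and> is_pb_index (shift_seq q ao u) z" for ao z
    using that exists_w_index[OF q2] pb_encode_props[of q u ao z k] u by (simp add: Let_def)
  fix t xs assume enc: "cpb_encoding q u t xs"
  obtain ao z \<xi> \<nu> w where t: "t = (ao, z, \<xi>, \<nu>, w)" using prod_cases5 by blast
  show xs: "xs \<in> cpb_seqs q k" using cpb_encoding_in_cpb_seqs[OF q2 u] enc t by simp
  then show "sum_list (part Pos xs) + sum_list (part Neg xs) = 0"
    using sum_list_parts[of xs] by (simp add: cpb_seqs_def charge_balanced_def)
  fix p \<phi> assume \<phi>: "prefix_map q k p \<phi>"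
  have mem: "t \<in> possible_params q k" using u enc by (auto simp: possible_params_def)
  then have pre: "\<phi> t \<in> cpb_seqs q p" using \<phi> by (auto simp: prefix_map_def)
  then show "\<phi> t @ xs \<in> cpb_seqs q (p + k)" using xs by (rule append_in_cpb_seqs)
  \<comment> \<open>The fixed prefix length lets the decoder split the codeword, and injectivity on
    the possible parameters recovers \<open>t\<close>.\<close>
  have "length (\<phi> t) = p" using pre by (simp add: cpb_seqs_def seqs_def)
  moreover have "inv_into (possible_params q k) \<phi> (\<phi> t) = t"
    using \<phi> mem by (simp add: prefix_map_def)
  ultimately show "cpb_decode q k p \<phi> (\<phi> t @ xs) = u"
    using cpb_encoding_decode[OF q2 u] enc t by (simp add: cpb_decode_def Let_def)
qed

end
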